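(* Let $n_1,\dots,n_t\ge3$ be integers (not necessarily distinct), $G=K_{n_1}\square\cdots\square K_{n_t}$, $N=\prod_{j=1}^t n_j$, and for each $j$ fix an instruction set generator $(\Delta_{n_j}^i)_{2\le i\le N}$ used for column $j$. Let $O'=(\sigma_i^j)$ be a weak order-generator for $V(G)$ and $O=\Phi_G(O')=(v^1,\dots,v^N)$ (rows). Then $O$ is an ordering of $V(G)$ that induces a consecutive radio labeling of $G$ if and only if $O$ has no repeated rows and, for every $1<i\le N$ and every integer $1\le s<t$ with $i-s\ge1$, at most $s-1$ indices $j\in\{1,\dots,t\}$ satisfy $\sigma_{i-s+1}^j\sigma_{i-s+2}^j\cdots\sigma_i^j\in\Lambda_{s,j}^{i-s+1}(\sigma_1^j,\dots,\sigma_{i-s}^j)$.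
   Context: $S_n$ is the symmetric group on $\{1,\dots,n\}$, with $\sigma\tau=\tau\circ\sigma$. An instruction set is $\{f_2,\dots,f_n\}\subset S_n$ ($n-1$ elements) with $f_k(k)=1$. An instruction set generator is a family of functions $\Delta_n^i:S_n^{i-1}\to\mathcal{P}(S_n)$, $2\le i\le N$, each value an instruction set. $V(K_n)=\{v_1,\dots,v_n\}$. Vertices of $G$ are $t$-tuples $(x_1,\dots,x_t)$ with $x_j\in V(K_{n_j})$; distance is the number of differing coordinates; $\mathrm{diam}(G)=t$. $S_n$ acts on $n$-tuples of distinct elements of $V(K_n)$ by $\sigma\cdot(v_{s_1},\dots,v_{s_n})=(v_{s_{\sigma^{-1}(1)}},\dots,v_{s_{\sigma^{-1}(n)}})$. For a column $(\sigma_1,\dots,\sigma_N)$ with $\sigma_1=\mathrm{id}$, $\sigma_2=f_2\in\Delta_n^2(\mathrm{id})$, $\sigma_i\in\Delta_n^i(\sigma_1,\dots,\sigma_{i-1})$, define $o_1=(v_1,\dots,v_n)$, $o_i=\sigma_i\cdot o_{i-1}$, and let $\phi_n(\sigma_1,\dots,\sigma_N)$ be the column of first coordinates of $o_1,\dots,o_N$. A weak order-generator is an $N\times t$ matrix $O'=(\sigma_i^j)$ whose column $j$ is such a column for $n=n_j$ and the generator $\Delta_{n_j}^i$ (first row all $\mathrm{id}$, second row all $f_2$). $\Phi_G(O')$ is the $N\times t$ matrix whose $j$-th column is $\phi_{n_j}$ of the $j$-th column of $O'$; its rows are vertices of $G$. For generator $\Delta_{n_j}^i$, $\Lambda_{s,j}^i(\rho_1,\dots,\rho_{i-1})$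 is the set of products $\tau_1\tau_2\cdots\tau_s$ with $\tau_k\in\Delta_{n_j}^{i+k-1}(\rho_1,\dots,\rho_{i-1},\tau_1,\dots,\tau_{k-1})$ and $\tau_1\cdots\tau_s(1)=1$. An ordering of $V(G)$ is a list of all vertices without repetition; a radio labeling is $f:V(G)\to\mathbb{Z}^+$ with $|f(u)-f(v)|\ge t+1-d(u,v)$ for distinct $u,v$, consecutive if bijective onto $\{1,\dots,N\}$; the labeling induced by an ordering $(v^1,\dots,v^N)$ is $f(v^1)=1$, $f(v^i)=\min\{x\in\mathbb{Z}:x>f(v^{i-1}),\ |x-f(v^l)|\ge t+1-d(v^i,v^l)\ \forall l<i\}$. *)

theory Defs
  imports Complex_Main "HOL-Library.FuncSet" "HOL-Combinatorics.Permutations"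
begin

section \<open>Graphs, distance and radio labelings\<close>

record 'v graph =
  verts :: "'v set"
  adj :: "'v \<Rightarrow> 'v \<Rightarrow> bool"

text \<open>The vertex \<open>v\<^sub>k\<close> of the complete graph is represented by the number \<open>k\<close>.\<close>

definition complete_graph :: "nat \<Rightarrow> nat graph" where
  "complete_graph n = \<lparr> verts = {1..n}, adj = (\<lambda>u v. u \<in> {1..n} \<and> v \<in> {1..n} \<and> u \<noteq> v) \<rparr>"

definition cartesian_product :: "'i set \<Rightarrow> ('i \<Rightarrow> 'v graph) \<Rightarrow> ('i \<Rightarrow> 'v) graph" where
  "cartesian_product I G =
     \<lparr> verts = (\<Pi>\<^sub>E j\<in>I. verts (G j)),
       adj = (\<lambda>x y. x \<in> (\<Pi>\<^sub>E j\<in>I. verts (G j)) \<and> y \<in> (\<Pi>\<^sub>E j\<in>I. verts (G j)) \<and>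
                    (\<exists>j\<in>I. adj (G j) (x j) (y j) \<and> (\<forall>k\<in>I - {j}. x k = y k))) \<rparr>"

definition hamming_graph :: "nat \<Rightarrow> (nat \<Rightarrow> nat) \<Rightarrow> (nat \<Rightarrow> nat) graph" where
  "hamming_graph t n = cartesian_product {1..t} (\<lambda>j. complete_graph (n j))"

text \<open>The relational power \<open>adj G ^^ k\<close> relates the ends of walks of length \<open>k\<close>. The value of
  \<open>gdist\<close> is only meaningful for vertices in the same component.\<close>

definition gdist :: "'v graph \<Rightarrow> 'v \<Rightarrow> 'v \<Rightarrow> nat" where
  "gdist G u v = (LEAST k. (adj G ^^ k) u v)"

definition gdiam :: "'v graph \<Rightarrow> nat" where
  "gdiam G = Max {gdist G u v | u v. u \<in> verts G \<and> v \<in> verts G}"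

definition radio_labeling :: "'v graph \<Rightarrow> ('v \<Rightarrow> int) \<Rightarrow> bool" where
  "radio_labeling G f \<longleftrightarrow>
     (\<forall>v\<in>verts G. f v > 0) \<and>
     (\<forall>u\<in>verts G. \<forall>v\<in>verts G. u \<noteq> v \<longrightarrow>
        \<bar>f u - f v\<bar> \<ge> int (gdiam G) + 1 - int (gdist G u v))"

definition consecutive_radio_labeling :: "'v graph \<Rightarrow> ('v \<Rightarrow> int) \<Rightarrow> bool" where
  "consecutive_radio_labeling G f \<longleftrightarrow>
     radio_labeling G f \<and> bij_betw f (verts G) {1..int (card (verts G))}"

text \<open>Lists of vertices are sequences indexed from 1; values at index 0 or beyond the number
  of vertices are irrelevant.\<close>

definition is_ordering :: "'v graph \<Rightarrow> (nat \<Rightarrow> 'v) \<Rightarrow> bool" where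
  "is_ordering G v \<longleftrightarrow> bij_betw v {1..card (verts G)} (verts G)"

text \<open>The integers above a given label form a set bounded below, and all large integers satisfy
  the finitely many constraints, so the least element on type \<open>int\<close> exists.\<close>

fun induced_label :: "'v graph \<Rightarrow> (nat \<Rightarrow> 'v) \<Rightarrow> nat \<Rightarrow> int" where
  "induced_label G v i =
     (if i \<le> 1 then 1
      else (LEAST x. x > induced_label G v (i - 1) \<and>
              (\<forall>l\<in>{1..<i}. \<bar>x - induced_label G v l\<bar>
                 \<ge> int (gdiam G) + 1 - int (gdist G (v i) (v l)))))"

declare induced_label.simps [simp del]

definition induced_labeling :: "'v graph \<Rightarrow> (nat \<Rightarrow> 'v) \<Rightarrow> 'v \<Rightarrow> int" where
  "induced_labeling G v u = induced_label G v (the_inv_into {1..card (verts G)} v u)"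

section \<open>Instruction sets and order-generators\<close>

text \<open>Elements of the symmetric group \<open>S\<^sub>n\<close> are functions \<open>\<sigma>\<close> with \<open>\<sigma> permutes {1..n}\<close>.
  Products are read from left to right: \<open>\<sigma>\<tau> = \<tau> \<circ> \<sigma>\<close>.\<close>

type_synonym perm = "nat \<Rightarrow> nat"

definition perm_mult :: "perm \<Rightarrow> perm \<Rightarrow> perm" where
  "perm_mult \<sigma> \<tau> = \<tau> \<circ> \<sigma>"

definition perm_prod :: "perm list \<Rightarrow> perm" where
  "perm_prod \<tau>s = foldr perm_mult \<tau>s id"

definition instruction_set :: "nat \<Rightarrow> perm set \<Rightarrow> bool" where
  "instruction_set n A \<longleftrightarrow>
     (\<exists>f. (\<forall>k\<in>{2..n}. f k permutes {1..n} \<and> f k k = 1) \<and> A = f ` {2..n})"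

text \<open>In \<open>\<Delta> i \<rho>s\<close> the list \<open>\<rho>s\<close> is the argument in \<open>S\<^sub>n\<^sup>i\<^sup>-\<^sup>1\<close>.\<close>

definition instruction_set_generator ::
    "nat \<Rightarrow> nat \<Rightarrow> (nat \<Rightarrow> perm list \<Rightarrow> perm set) \<Rightarrow> bool" where
  "instruction_set_generator n N \<Delta> \<longleftrightarrow>
     (\<forall>i\<in>{2..N}. \<forall>\<rho>s. length \<rho>s = i - 1 \<and> (\<forall>\<rho>\<in>set \<rho>s. \<rho> permutes {1..n}) \<longrightarrow>
        instruction_set n (\<Delta> i \<rho>s))"

text \<open>The action of \<open>S\<^sub>n\<close> on \<open>n\<close>-tuples, a tuple being a function on the positions \<open>{1..n}\<close>.\<close>

definition perm_act :: "nat \<Rightarrow> perm \<Rightarrow> (nat \<Rightarrow> nat) \<Rightarrow> (nat \<Rightarrow> nat)" where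
  "perm_act n \<sigma> x = (\<lambda>k\<in>{1..n}. x (inv \<sigma> k))"

text \<open>The second row is the element \<open>f\<^sub>2\<close> of \<open>\<Delta> 2 [id]\<close>, i.e. the one mapping \<open>2\<close> to \<open>1\<close>.\<close>

definition generator_column ::
    "nat \<Rightarrow> nat \<Rightarrow> (nat \<Rightarrow> perm list \<Rightarrow> perm set) \<Rightarrow> (nat \<Rightarrow> perm) \<Rightarrow> bool" where
  "generator_column n N \<Delta> \<sigma> \<longleftrightarrow>
     \<sigma> 1 = id \<and>
     \<sigma> 2 \<in> \<Delta> 2 [id] \<and> \<sigma> 2 2 = 1 \<and>
     (\<forall>i\<in>{2..N}. \<sigma> i \<in> \<Delta> i (map \<sigma> [1..<i]))"

fun column_tuple :: "nat \<Rightarrow> (nat \<Rightarrow> perm) \<Rightarrow> nat \<Rightarrow> (nat \<Rightarrow> nat)" where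
  "column_tuple n \<sigma> i =
     (if i \<le> 1 then (\<lambda>k\<in>{1..n}. k) else perm_act n (\<sigma> i) (column_tuple n \<sigma> (i - 1)))"

declare column_tuple.simps [simp del]

definition phi :: "nat \<Rightarrow> (nat \<Rightarrow> perm) \<Rightarrow> nat \<Rightarrow> nat" where
  "phi n \<sigma> i = column_tuple n \<sigma> i 1"

text \<open>A matrix \<open>\<sigma>\<close> has the entry \<open>\<sigma> i j\<close> in row \<open>i\<close> and column \<open>j\<close>; \<open>\<Delta> j\<close> is the generator
  used for column \<open>j\<close>.\<close>

definition weak_order_generator ::
    "nat \<Rightarrow> (nat \<Rightarrow> nat) \<Rightarrow> nat \<Rightarrow> (nat \<Rightarrow> nat \<Rightarrow> perm list \<Rightarrow> perm set) \<Rightarrow>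
     (nat \<Rightarrow> nat \<Rightarrow> perm) \<Rightarrow> bool" where
  "weak_order_generator t n N \<Delta> \<sigma> \<longleftrightarrow>
     (\<forall>j\<in>{1..t}. generator_column (n j) N (\<Delta> j) (\<lambda>i. \<sigma> i j))"

definition Phi :: "nat \<Rightarrow> (nat \<Rightarrow> nat) \<Rightarrow> (nat \<Rightarrow> nat \<Rightarrow> perm) \<Rightarrow> nat \<Rightarrow> (nat \<Rightarrow> nat)" where
  "Phi t n \<sigma> i = (\<lambda>j\<in>{1..t}. phi (n j) (\<lambda>l. \<sigma> l j) i)"

definition Lam :: "(nat \<Rightarrow> perm list \<Rightarrow> perm set) \<Rightarrow> nat \<Rightarrow> nat \<Rightarrow> perm list \<Rightarrow> perm set" where
  "Lam \<Delta> s i \<rho>s =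
     {perm_prod \<tau>s | \<tau>s. length \<tau>s = s \<and>
        (\<forall>k\<in>{1..s}. \<tau>s ! (k - 1) \<in> \<Delta> (i + k - 1) (\<rho>s @ take (k - 1) \<tau>s)) \<and>
        perm_prod \<tau>s 1 = 1}"

section \<open>Distance and diameter of Hamming graphs\<close>

lemma verts_hamming_graph: "verts (hamming_graph t n) = (\<Pi>\<^sub>E j\<in>{1..t}. {1..n j})"
  by (simp add: hamming_graph_def cartesian_product_def complete_graph_def)

lemma card_verts_hamming_graph: "card (verts (hamming_graph t n)) = (\<Prod>j\<in>{1..t}. n j)"
  by (simp add: verts_hamming_graph card_PiE)

lemma adj_hamming_graph:
  "adj (hamming_graph t n) x y \<longleftrightarrow>
     x \<in> verts (hamming_graph t n) \<and> y \<in> verts (hamming_graph t n) \<and>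
     (\<exists>j\<in>{1..t}. x j \<noteq> y j \<and> (\<forall>k\<in>{1..t} - {j}. x k = y k))"
  unfolding verts_hamming_graph
  by (auto simp: hamming_graph_def cartesian_product_def complete_graph_def PiE_iff)

lemma hamming_walk_lower:
  assumes "(adj (hamming_graph t n) ^^ m) x y"
  shows "card {j\<in>{1..t}. x j \<noteq> y j} \<le> m"
  using assms
proof (induction m arbitrary: y)
  case 0
  then show ?case by simp
next
  case (Suc m)
  then obtain z where z: "(adj (hamming_graph t n) ^^ m) x z" "adj (hamming_graph t n) z y"
    by auto
  from z(2) obtain j where j: "\<forall>k\<in>{1..t} - {j}. z k = y k"
    by (auto simp: adj_hamming_graph)
  have "{j\<in>{1..t}. x j \<noteq> y j} \<subseteq> insert j {j\<in>{1..t}. x j \<noteq> z j}"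
    using j by auto
  then have "card {j\<in>{1..t}. x j \<noteq> y j} \<le> card (insert j {j\<in>{1..t}. x j \<noteq> z j})"
    by (intro card_mono) auto
  also have "\<dots> \<le> Suc (card {j\<in>{1..t}. x j \<noteq> z j})"
    by (simp add: card_insert_if)
  finally show ?case using Suc.IH[OF z(1)] by simp
qed

lemma hamming_walk_exists:
  assumes "x \<in> verts (hamming_graph t n)" "y \<in> verts (hamming_graph t n)"
  shows "(adj (hamming_graph t n) ^^ card {j\<in>{1..t}. x j \<noteq> y j}) x y"
  using assms(2)
proof (induction "card {j\<in>{1..t}. x j \<noteq> y j}" arbitrary: y)
  case 0
  then have "\<forall>j\<in>{1..t}. x j = y j" by simp
  then have "x = y"
    using assms(1) 0(2) unfolding verts_hamming_graph by (intro PiE_ext) auto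
  with 0 show ?case by simp
next
  case (Suc m)
  then obtain i where i: "i \<in> {j\<in>{1..t}. x j \<noteq> y j}"
    by (metis (no_types, lifting) card.empty ex_in_conv nat.distinct(1))
  define z where "z = y(i := x i)"
  have z: "z \<in> verts (hamming_graph t n)"
    using Suc.prems assms(1) i unfolding verts_hamming_graph z_def by (auto simp: PiE_iff extensional_def)
  have "{j\<in>{1..t}. x j \<noteq> z j} = {j\<in>{1..t}. x j \<noteq> y j} - {i}"
    by (auto simp: z_def)
  then have m: "m = card {j\<in>{1..t}. x j \<noteq> z j}"
    using i Suc.hyps(2) by simp
  have "adj (hamming_graph t n) z y"
    using i z Suc.prems unfolding adj_hamming_graph by (auto simp: z_def)
  with Suc.hyps(1)[OF m z] have "(adj (hamming_graph t n) ^^ Suc m) x y"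
    unfolding m by auto
  then show ?case using Suc.hyps(2) by simp
qed

lemma gdist_hamming_graph:
  assumes "x \<in> verts (hamming_graph t n)" "y \<in> verts (hamming_graph t n)"
  shows "gdist (hamming_graph t n) x y = card {j\<in>{1..t}. x j \<noteq> y j}"
  unfolding gdist_def
proof (rule Least_equality)
  show "(adj (hamming_graph t n) ^^ card {j\<in>{1..t}. x j \<noteq> y j}) x y"
    by (rule hamming_walk_exists[OF assms])
  show "card {j\<in>{1..t}. x j \<noteq> y j} \<le> k" if "(adj (hamming_graph t n) ^^ k) x y" for k
    by (rule hamming_walk_lower[OF that])
qed

lemma gdiam_hamming_graph:
  assumes "\<And>j. j \<in> {1..t} \<Longrightarrow> n j \<ge> 2"
  shows "gdiam (hamming_graph t n) = t"
  unfolding gdiam_def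
proof (rule Max_eqI)
  let ?V = "verts (hamming_graph t n)"
  let ?D = "{gdist (hamming_graph t n) u v | u v. u \<in> ?V \<and> v \<in> ?V}"
  have le: "d \<le> t" if "d \<in> ?D" for d
  proof -
    from that obtain u v where uv: "u \<in> ?V" "v \<in> ?V" "d = gdist (hamming_graph t n) u v"
      by blast
    have "card {j\<in>{1..t}. u j \<noteq> v j} \<le> card {1..t}" by (intro card_mono) auto
    with uv show ?thesis by (simp add: gdist_hamming_graph)
  qed
  then show "finite ?D" by (meson finite_nat_set_iff_bounded_le)
  show "d \<le> t" if "d \<in> ?D" for d using le that .
  define a b :: "nat \<Rightarrow> nat" where "a = (\<lambda>j\<in>{1..t}. 1)" and "b = (\<lambda>j\<in>{1..t}. 2)"
  have ab: "a \<in> ?V" "b \<in> ?V"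
    using assms unfolding verts_hamming_graph a_def b_def
    by (force simp: PiE_iff)+
  have "{j\<in>{1..t}. a j \<noteq> b j} = {1..t}" by (auto simp: a_def b_def)
  then have "gdist (hamming_graph t n) a b = t" using ab by (simp add: gdist_hamming_graph)
  with ab show "t \<in> ?D" by force
qed

end

theory Submission
  imports Defs
begin

text \<open>Since \<open>o\<^sub>i = (\<sigma>\<^sub>m\<^sub>+\<^sub>1 \<dots> \<sigma>\<^sub>i) \<cdot> o\<^sub>m\<close> and every \<open>o\<^sub>i\<close> has distinct entries, the tuples \<open>o\<^sub>m\<close> and
  \<open>o\<^sub>i\<close> have the same first entry iff the product \<open>\<sigma>\<^sub>m\<^sub>+\<^sub>1 \<dots> \<sigma>\<^sub>i\<close> fixes \<open>1\<close>, and the factors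
  themselves witness that such a product lies in \<open>\<Lambda>\<close>. So the condition on \<open>\<Lambda>\<close> says that rows
  \<open>i - s\<close> and \<open>i\<close> agree in at most \<open>s - 1\<close> columns, i.e. have distance at least \<open>t + 1 - s\<close>; for
  \<open>s \<ge> t\<close> this only asks the rows to differ. On the other side, the induced labels increase
  strictly from \<open>1\<close>, so they are consecutive iff the \<open>i\<close>-th label is \<open>i\<close>, iff these same distance
  bounds hold.\<close>

section \<open>Consecutive induced labelings\<close>

text \<open>\<open>int\<close> is not well-ordered, so the least element has to come from the lower
  bound: shifting by \<open>b\<close> moves the search to \<open>nat\<close>.\<close>

lemma LeastI_int:
  fixes P :: "int \<Rightarrow> bool"
  assumes "P x" and bound: "\<And>y. P y \<Longrightarrow> b \<le> y"
  shows "P (LEAST y. P y)"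
proof -
  define k where "k = (LEAST k. P (b + int k))"
  have "P (b + int (nat (x - b)))"
    using assms bound[of x] by simp
  then have k: "P (b + int k)"
    unfolding k_def by (rule LeastI)
  have "(LEAST y. P y) = b + int k"
  proof (rule Least_equality)
    fix y assume "P y"
    then have "P (b + int (nat (y - b)))" "b \<le> y"
      using bound[of y] by simp_all
    then have "k \<le> nat (y - b)"
      unfolding k_def by (intro Least_le)
    with \<open>b \<le> y\<close> show "b + int k \<le> y" by simp
  qed (rule k)
  with k show ?thesis by simp
qed

lemma induced_label_1 [simp]: "induced_label G v (Suc 0) = 1"
  by (simp add: induced_label.simps)

text \<open>Strictness is built into the minimized predicate; what needs proof is that some integer
  satisfies this predicate, so that its \<open>LEAST\<close> does too.\<close>

lemma induced_label_strict:
  assumes "1 \<le> i"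
  shows "induced_label G v i < induced_label G v (Suc i)"
proof -
  let ?L = "induced_label G v"
  let ?P = "\<lambda>x. x > ?L i \<and> (\<forall>l\<in>{1..<Suc i}. \<bar>x - ?L l\<bar>
              \<ge> int (gdiam G) + 1 - int (gdist G (v (Suc i)) (v l)))"
  \<comment> \<open>No earlier label exceeds \<open>M\<close>, so
    \<open>M + int (gdiam G) + 1\<close> differs from each of them by at least
    \<open>gdiam G + 1\<close>, whatever the graph distances are.\<close>
  define M where "M = (\<Sum>l\<in>{1..<Suc i}. \<bar>?L l\<bar>)"
  have M: "\<bar>?L l\<bar> \<le> M" if "l \<in> {1..<Suc i}" for l
    unfolding M_def using that by (intro member_le_sum) auto
  have "?P (M + int (gdiam G) + 1)"
  proof (intro conjI ballI)
    show "M + int (gdiam G) + 1 > ?L i" using M[of i] assms by simp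
    fix l assume "l \<in> {1..<Suc i}"
    from M[OF this] show "\<bar>M + int (gdiam G) + 1 - ?L l\<bar>
              \<ge> int (gdiam G) + 1 - int (gdist G (v (Suc i)) (v l))" by simp
  qed
  then have "?P (LEAST x. ?P x)"
    by (rule LeastI_int[where b = "?L i"]) simp
  moreover have "?L (Suc i) = (LEAST x. ?P x)"
    using assms by (subst induced_label.simps) simp
  ultimately show ?thesis by simp
qed

lemma induced_label_diff:
  assumes "1 \<le> i" "i \<le> k"
  shows "int k - int i \<le> induced_label G v k - induced_label G v i"
  using assms(2)
proof (induction k rule: dec_induct)
  case (step k)
  with induced_label_strict[of k G v] assms(1) show ?case by simp
qed simp

text \<open>The greedy choice skips no value: once the earlier labels equal their indices,
  \<open>dist\<close> makes \<open>int i\<close> admissible, and nothing smaller exceeds the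
  previous label \<open>i - 1\<close>.\<close>

lemma induced_label_eq_index:
  assumes "1 \<le> i" "i \<le> c"
    and dist: "\<And>l k. \<lbrakk>1 \<le> l; l < k; k \<le> c\<rbrakk> \<Longrightarrow>
          int (gdiam G) + 1 - int (gdist G (v k) (v l)) \<le> int k - int l"
  shows "induced_label G v i = int i"
  using assms(1,2)
proof (induction i rule: less_induct)
  case (less i)
  show ?case
  proof (cases "i = 1")
    case False
    with less.prems have i: "1 < i" by simp
    have IH: "induced_label G v l = int l" if "1 \<le> l" "l < i" for l
      using less that by simp
    show ?thesis
      using i less.prems
    proof (subst induced_label.simps, simp, intro Least_equality conjI ballI)
      show "int i > induced_label G v (i - Suc 0)"
        using i IH[of "i - 1"] by simp
      fix l assume "l \<in> {Suc 0..<i}"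
      then show "int (gdiam G) + 1 - int (gdist G (v i) (v l)) \<le> \<bar>int i - induced_label G v l\<bar>"
        using IH[of l] dist[of l i] less.prems by simp
    next
      fix y assume "induced_label G v (i - Suc 0) < y \<and>
         (\<forall>l\<in>{Suc 0..<i}. int (gdiam G) + 1 - int (gdist G (v i) (v l)) \<le> \<bar>y - induced_label G v l\<bar>)"
      then show "int i \<le> y" using i IH[of "i - 1"] by simp
    qed
  qed simp
qed

text \<open>The right-hand side measures distance from the later vertex to the earlier one, while a
  radio labeling constrains both orders; \<open>sym\<close> bridges this.\<close>

lemma consecutive_induced_labeling_iff:
  assumes ord: "is_ordering G v"
    and sym: "\<And>x y. \<lbrakk>x \<in> verts G; y \<in> verts G\<rbrakk> \<Longrightarrow> gdist G x y = gdist G y x"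
  shows "consecutive_radio_labeling G (induced_labeling G v) \<longleftrightarrow>
    (\<forall>l k. 1 \<le> l \<and> l < k \<and> k \<le> card (verts G) \<longrightarrow>
       int (gdiam G) + 1 - int (gdist G (v k) (v l)) \<le> int k - int l)"
    (is "?lhs \<longleftrightarrow> ?rhs")
proof -
  let ?c = "card (verts G)"
  have bij: "bij_betw v {1..?c} (verts G)"
    using ord by (simp add: is_ordering_def)
  have label: "induced_labeling G v (v i) = induced_label G v i" if "i \<in> {1..?c}" for i
    unfolding induced_labeling_def
    using the_inv_into_f_f[OF bij_betw_imp_inj_on[OF bij] that] by simp
  have v_in: "v i \<in> verts G" if "i \<in> {1..?c}" for i
    using bij that by (rule bij_betwE[rule_format])
  have verts_eq: "verts G = v ` {1..?c}"
    using bij by (simp add: bij_betw_def)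
  show ?thesis
  proof
    assume lhs: ?lhs
    \<comment> \<open>A squeeze: the first label is 1, the last is at most \<open>?c\<close>, and
      each step adds at least 1, which leaves no slack on either side of \<open>i\<close>.\<close>
    have eq: "induced_label G v i = int i" if i: "i \<in> {1..?c}" for i
    proof -
      have "induced_labeling G v (v ?c) \<in> {1..int ?c}"
        using lhs v_in[of ?c] i unfolding consecutive_radio_labeling_def
        by (auto dest: bij_betwE)
      then have "induced_label G v ?c \<le> int ?c"
        using label[of ?c] i by simp
      moreover have "int ?c - int i \<le> induced_label G v ?c - induced_label G v i"
        using i by (intro induced_label_diff) auto
      moreover have "int i - 1 \<le> induced_label G v i - 1"
        using i induced_label_diff[of 1 i G v] by simp
      ultimately show ?thesis by simp
    qed
    show ?rhs
    proof (intro allI impI)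
      fix l k assume lk: "1 \<le> l \<and> l < k \<and> k \<le> ?c"
      then have "v k \<noteq> v l"
        using bij_betw_imp_inj_on[OF bij] by (auto dest: inj_onD)
      with lhs lk v_in[of k] v_in[of l]
      have "int (gdiam G) + 1 - int (gdist G (v k) (v l))
          \<le> \<bar>induced_labeling G v (v k) - induced_labeling G v (v l)\<bar>"
        unfolding consecutive_radio_labeling_def radio_labeling_def by simp
      then show "int (gdiam G) + 1 - int (gdist G (v k) (v l)) \<le> int k - int l"
        using lk by (simp add: label eq)
    qed
  next
    assume rhs: ?rhs
    have eq: "induced_labeling G v (v i) = int i" if "i \<in> {1..?c}" for i
      using induced_label_eq_index[of i ?c G v] rhs that by (simp add: label)
    have "radio_labeling G (induced_labeling G v)"
      unfolding radio_labeling_def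
    proof (intro conjI ballI impI)
      fix x assume "x \<in> verts G"
      then obtain i where "x = v i" "i \<in> {1..?c}"
        using verts_eq by (metis imageE)
      then show "0 < induced_labeling G v x" by (simp add: eq)
    next
      fix x y assume xy: "x \<in> verts G" "y \<in> verts G" "x \<noteq> y"
      then obtain i k where ik: "x = v i" "y = v k" "i \<in> {1..?c}" "k \<in> {1..?c}"
        using verts_eq by (metis imageE)
      with xy have "i \<noteq> k" by auto
      then show "int (gdiam G) + 1 - int (gdist G x y)
          \<le> \<bar>induced_labeling G v x - induced_labeling G v y\<bar>"
        using rhs[rule_format, of i k] rhs[rule_format, of k i] ik sym[OF xy(1,2)]
        by (cases "i < k") (simp_all add: eq)
    qed
    \<comment> \<open>Pulled back along the bijection \<open>v\<close>, the labeling is just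
      \<open>int\<close> on the indices, so bijectivity is checked there.\<close>
    moreover have "bij_betw (induced_labeling G v) (verts G) {1..int ?c}"
    proof -
      have "bij_betw int {1..?c} {1..int ?c}"
        by (rule bij_betwI[where g = nat]) auto
      moreover have "bij_betw int {1..?c} {1..int ?c} \<longleftrightarrow>
          bij_betw (induced_labeling G v \<circ> v) {1..?c} {1..int ?c}"
        by (rule bij_betw_cong) (simp add: eq)
      ultimately show ?thesis
        using bij_betw_comp_iff[OF bij] by blast
    qed
    ultimately show ?lhs
      by (simp add: consecutive_radio_labeling_def)
  qed
qed

section \<open>Products in a generator column\<close>

lemma perm_prod_Nil [simp]: "perm_prod [] = id"
  by (simp add: perm_prod_def)

lemma perm_prod_snoc: "perm_prod (\<tau>s @ [\<tau>]) = \<tau> \<circ> perm_prod \<tau>s"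
  by (induction \<tau>s) (simp_all add: perm_prod_def perm_mult_def o_assoc)

lemma permutes_perm_prod:
  "(\<And>\<tau>. \<tau> \<in> set \<tau>s \<Longrightarrow> \<tau> permutes A) \<Longrightarrow> perm_prod \<tau>s permutes A"
  by (induction \<tau>s) (auto simp: perm_prod_def perm_mult_def permutes_id intro: permutes_compose)

lemma instruction_set_permutes: "\<lbrakk>instruction_set n A; \<tau> \<in> A\<rbrakk> \<Longrightarrow> \<tau> permutes {1..n}"
  by (auto simp: instruction_set_def)

text \<open>Strong induction is natural here: \<open>\<Delta> i\<close> is known to give an
  instruction set only when all earlier rows are permutations.\<close>

lemma generator_column_permutes:
  assumes gen: "instruction_set_generator n N \<Delta>" and col: "generator_column n N \<Delta> \<sigma>"
    and "1 \<le> i" "i \<le> N"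
  shows "\<sigma> i permutes {1..n}"
  using assms(3,4)
proof (induction i rule: less_induct)
  case (less i)
  show ?case
  proof (cases "i = 1")
    case True
    with col show ?thesis by (simp only: generator_column_def permutes_id)
  next
    case False
    with less.prems have i: "i \<in> {2..N}" by simp
    have "\<forall>\<rho>\<in>set (map \<sigma> [1..<i]). \<rho> permutes {1..n}"
      using less by auto
    with gen i have "instruction_set n (\<Delta> i (map \<sigma> [1..<i]))"
      unfolding instruction_set_generator_def by simp
    then show ?thesis
      using col i by (intro instruction_set_permutes) (auto simp: generator_column_def)
  qed
qed

text \<open>Acting by a permutation \<open>\<tau>\<close> moves the entry at position
  \<open>k\<close> to position \<open>\<tau> k\<close>. The product of rows \<open>m + 1\<close> to
  \<open>i\<close> thus tracks where an entry of the \<open>m\<close>-th tuple ends up.\<close>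

lemma column_tuple_perm_prod:
  assumes perm: "\<And>l. \<lbrakk>1 \<le> l; l \<le> i\<rbrakk> \<Longrightarrow> \<sigma> l permutes {1..n}"
    and "1 \<le> m" "m \<le> i" "k \<in> {1..n}"
  shows "column_tuple n \<sigma> i (perm_prod (map \<sigma> [Suc m..<Suc i]) k) = column_tuple n \<sigma> m k"
  using assms(3) perm
proof (induction i rule: dec_induct)
  case (step i)
  let ?P = "perm_prod (map \<sigma> [Suc m..<Suc i])"
  have "?P permutes {1..n}"
    using step.prems step.hyps \<open>1 \<le> m\<close> by (intro permutes_perm_prod) auto
  then have "?P k \<in> {1..n}"
    using \<open>k \<in> {1..n}\<close> by (simp only: permutes_in_image)
  moreover have \<sigma>: "\<sigma> (Suc i) permutes {1..n}"
    using step.prems by simp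
  ultimately have "\<sigma> (Suc i) (?P k) \<in> {1..n}"
    by (simp only: permutes_in_image)
  moreover have "perm_prod (map \<sigma> [Suc m..<Suc (Suc i)]) = \<sigma> (Suc i) \<circ> ?P"
    using upt_Suc_append[of "Suc m" "Suc i"] step.hyps
    by (simp add: perm_prod_snoc del: upt_Suc)
  moreover have "column_tuple n \<sigma> (Suc i) = perm_act n (\<sigma> (Suc i)) (column_tuple n \<sigma> i)"
    using step.hyps \<open>1 \<le> m\<close> by (subst column_tuple.simps) simp
  ultimately have "column_tuple n \<sigma> (Suc i) (perm_prod (map \<sigma> [Suc m..<Suc (Suc i)]) k)
      = column_tuple n \<sigma> i (?P k)"
    using permutes_inverses(2)[OF \<sigma>] by (simp add: perm_act_def del: upt_Suc)
  with step.IH step.prems show ?case by simp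
qed simp

text \<open>The initial tuple is the identity on positions, so tracking from row 1 exhibits the
  \<open>i\<close>-th tuple as inverse to a permutation.\<close>

lemma bij_betw_column_tuple:
  assumes perm: "\<And>l. \<lbrakk>1 \<le> l; l \<le> i\<rbrakk> \<Longrightarrow> \<sigma> l permutes {1..n}" and "1 \<le> i"
  shows "bij_betw (column_tuple n \<sigma> i) {1..n} {1..n}"
proof -
  let ?P = "perm_prod (map \<sigma> [Suc 1..<Suc i])"
  have P: "bij_betw ?P {1..n} {1..n}"
    using perm by (intro permutes_imp_bij permutes_perm_prod) auto
  have "(column_tuple n \<sigma> i \<circ> ?P) k = k" if "k \<in> {1..n}" for k
    using column_tuple_perm_prod[of i \<sigma> n 1 k] assms that
    by (simp add: column_tuple.simps[of n \<sigma> "Suc 0"] del: upt_Suc)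
  then have "bij_betw (column_tuple n \<sigma> i \<circ> ?P) {1..n} {1..n}"
    using bij_betw_cong[of "{1..n}" "column_tuple n \<sigma> i \<circ> ?P" id "{1..n}"] by simp
  then show ?thesis
    using bij_betw_comp_iff[OF P] by blast
qed

lemma phi_eq_iff:
  assumes perm: "\<And>l. \<lbrakk>1 \<le> l; l \<le> i\<rbrakk> \<Longrightarrow> \<sigma> l permutes {1..n}"
    and "1 \<le> m" "m \<le> i" "1 \<le> n"
  shows "phi n \<sigma> i = phi n \<sigma> m \<longleftrightarrow> perm_prod (map \<sigma> [Suc m..<Suc i]) 1 = 1"
proof -
  let ?P = "perm_prod (map \<sigma> [Suc m..<Suc i])"
  have "?P permutes {1..n}"
    using assms by (intro permutes_perm_prod) auto
  then have P: "?P 1 \<in> {1..n}"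
    using \<open>1 \<le> n\<close> permutes_in_image[of ?P "{1..n}" 1] by simp
  have inj: "inj_on (column_tuple n \<sigma> i) {1..n}"
    using assms by (intro bij_betw_imp_inj_on[OF bij_betw_column_tuple]) auto
  have one: "1 \<in> {1..n}"
    using \<open>1 \<le> n\<close> by simp
  \<comment> \<open>The first entry of the earlier tuple now sits at position \<open>?P 1\<close>;
    the question becomes whether positions \<open>1\<close> and \<open>?P 1\<close> of one injective
    tuple agree.\<close>
  have "phi n \<sigma> m = column_tuple n \<sigma> i (?P 1)"
    unfolding phi_def by (rule column_tuple_perm_prod[OF perm assms(2,3) one, symmetric])
  then have "phi n \<sigma> i = phi n \<sigma> m \<longleftrightarrow>
      column_tuple n \<sigma> i 1 = column_tuple n \<sigma> i (?P 1)"
    by (simp only: phi_def)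
  also have "\<dots> \<longleftrightarrow> ?P 1 = 1"
    using inj_on_eq_iff[OF inj one P] by (simp only: eq_commute)
  finally show ?thesis .
qed

text \<open>Fixing \<open>1\<close> is demanded of every element of \<open>Lam\<close>, whichever
  factorization produced it, so only the converse needs the column.\<close>

lemma perm_prod_in_Lam_iff:
  assumes col: "generator_column n N \<Delta> \<sigma>" and "1 \<le> m" "m + s \<le> N"
  shows "perm_prod (map \<sigma> [Suc m..<Suc (m + s)]) \<in> Lam \<Delta> s (Suc m) (map \<sigma> [1..<Suc m])
    \<longleftrightarrow> perm_prod (map \<sigma> [Suc m..<Suc (m + s)]) 1 = 1"
proof
  assume "perm_prod (map \<sigma> [Suc m..<Suc (m + s)]) 1 = 1"
  \<comment> \<open>The \<open>k\<close>-th factor is row \<open>m + k\<close>, and the history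
    passed to \<open>\<Delta>\<close> is exactly rows \<open>1\<close> to \<open>m + k - 1\<close>,
    as in the column condition.\<close>
  moreover have "map \<sigma> [Suc m..<Suc (m + s)] ! (k - 1) \<in>
      \<Delta> (Suc m + k - 1) (map \<sigma> [1..<Suc m] @ take (k - 1) (map \<sigma> [Suc m..<Suc (m + s)]))"
    if k: "k \<in> {1..s}" for k
  proof -
    have "map \<sigma> [Suc m..<Suc (m + s)] ! (k - 1) = \<sigma> (m + k)"
      using k by (cases k) (simp_all del: upt_Suc)
    moreover have "take (k - 1) [Suc m..<Suc (m + s)] = [Suc m..<m + k]"
      using k by (subst take_upt) auto
    moreover have "[1..<Suc m] @ [Suc m..<m + k] = [1..<m + k]"
      using k upt_add_eq_append[of 1 "Suc m" "k - 1"] by simp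
    ultimately show ?thesis
      using col k assms
      by (simp add: generator_column_def take_map flip: map_append del: upt_Suc)
  qed
  ultimately show "perm_prod (map \<sigma> [Suc m..<Suc (m + s)])
      \<in> Lam \<Delta> s (Suc m) (map \<sigma> [1..<Suc m])"
    unfolding Lam_def
    by (intro CollectI exI[of _ "map \<sigma> [Suc m..<Suc (m + s)]"]) (simp del: upt_Suc)
qed (auto simp: Lam_def)

section \<open>Agreeing columns, distances of rows and the equivalence\<close>

theorem theorem30:
  fixes t N :: nat
    and n :: "nat \<Rightarrow> nat"
    and \<Delta> :: "nat \<Rightarrow> nat \<Rightarrow> perm list \<Rightarrow> perm set"
    and \<sigma> :: "nat \<Rightarrow> nat \<Rightarrow> perm"
  assumes "t \<ge> 1"
    and "\<And>j. j \<in> {1..t} \<Longrightarrow> n j \<ge> 3"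
    and "N = (\<Prod>j\<in>{1..t}. n j)"
    and "\<And>j. j \<in> {1..t} \<Longrightarrow> instruction_set_generator (n j) N (\<Delta> j)"
    and "weak_order_generator t n N \<Delta> \<sigma>"
  shows "(is_ordering (hamming_graph t n) (Phi t n \<sigma>) \<and>
          consecutive_radio_labeling (hamming_graph t n)
            (induced_labeling (hamming_graph t n) (Phi t n \<sigma>)))
     \<longleftrightarrow>
         (inj_on (Phi t n \<sigma>) {1..N} \<and>
          (\<forall>i s. 1 < i \<and> i \<le> N \<and> 1 \<le> s \<and> s < t \<and> s < i \<longrightarrow>
             card {j \<in> {1..t}.
                     perm_prod (map (\<lambda>l. \<sigma> l j) [i - s + 1..<i + 1])
                       \<in> Lam (\<Delta> j) s (i - s + 1) (map (\<lambda>l. \<sigma> l j) [1..<i - s + 1])}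
               \<le> s - 1))"
proof -
  let ?G = "hamming_graph t n"
  let ?v = "Phi t n \<sigma>"
  let ?agree = "\<lambda>i m. {j \<in> {1..t}. ?v i j = ?v m j}"
  have card_V: "card (verts ?G) = N"
    unfolding assms(3) by (rule card_verts_hamming_graph)
  have diam: "gdiam ?G = t"
    using assms(2) by (intro gdiam_hamming_graph) force
  have sym: "gdist ?G x y = gdist ?G y x" if "x \<in> verts ?G" "y \<in> verts ?G" for x y
    by (simp only: gdist_hamming_graph that eq_commute[of "x _"])
  have col: "generator_column (n j) N (\<Delta> j) (\<lambda>l. \<sigma> l j)" if "j \<in> {1..t}" for j
    using assms(5) that unfolding weak_order_generator_def by blast
  have perm: "\<sigma> l j permutes {1..n j}" if "j \<in> {1..t}" "1 \<le> l" "l \<le> N" for j l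
    by (rule generator_column_permutes[OF assms(4)[OF that(1)] col[OF that(1)] that(2,3)])
  have v_in: "?v i \<in> verts ?G" if "i \<in> {1..N}" for i
  proof -
    have "phi (n j) (\<lambda>l. \<sigma> l j) i \<in> {1..n j}" if j: "j \<in> {1..t}" for j
    proof -
      have "bij_betw (column_tuple (n j) (\<lambda>l. \<sigma> l j) i) {1..n j} {1..n j}"
        using \<open>i \<in> {1..N}\<close> perm j by (intro bij_betw_column_tuple) auto
      moreover have "1 \<in> {1..n j}"
        using assms(2)[OF j] by simp
      ultimately show ?thesis
        unfolding phi_def by (rule bij_betwE[rule_format])
    qed
    then show ?thesis
      unfolding verts_hamming_graph Phi_def by (intro restrict_PiE_iff[THEN iffD2]) blast
  qed
  \<comment> \<open>There are as many rows as vertices, so injectivity already gives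
    surjectivity.\<close>
  have ordering: "is_ordering ?G ?v \<longleftrightarrow> inj_on ?v {1..N}"
  proof
    assume inj: "inj_on ?v {1..N}"
    have "finite (verts ?G)"
      by (simp add: verts_hamming_graph finite_PiE)
    moreover have "?v ` {1..N} \<subseteq> verts ?G"
      using v_in by blast
    ultimately have "?v ` {1..N} = verts ?G"
      using card_image[OF inj] card_V by (intro card_subset_eq) simp_all
    with inj show "is_ordering ?G ?v"
      by (simp add: is_ordering_def card_V bij_betw_def)
  qed (simp add: is_ordering_def card_V bij_betw_def)
  have Lam_set: "{j \<in> {1..t}. perm_prod (map (\<lambda>l. \<sigma> l j) [i - s + 1..<i + 1])
                   \<in> Lam (\<Delta> j) s (i - s + 1) (map (\<lambda>l. \<sigma> l j) [1..<i - s + 1])}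
               = ?agree i (i - s)" if si: "s < i" "i \<le> N" for i s
  proof (rule Collect_cong, rule conj_cong[OF refl])
    fix j assume j: "j \<in> {1..t}"
    have "phi (n j) (\<lambda>l. \<sigma> l j) i = phi (n j) (\<lambda>l. \<sigma> l j) (i - s) \<longleftrightarrow>
        perm_prod (map (\<lambda>l. \<sigma> l j) [Suc (i - s)..<Suc i]) 1 = 1"
      using si perm j assms(2)[OF j] by (intro phi_eq_iff) auto
    with j si show "perm_prod (map (\<lambda>l. \<sigma> l j) [i - s + 1..<i + 1])
        \<in> Lam (\<Delta> j) s (i - s + 1) (map (\<lambda>l. \<sigma> l j) [1..<i - s + 1]) \<longleftrightarrow> ?v i j = ?v (i - s) j"
      using perm_prod_in_Lam_iff[OF col[OF j], of "i - s" s]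
      by (simp add: Phi_def del: upt_Suc)
  qed
  have dist: "int (gdist ?G (?v i) (?v m)) = int t - int (card (?agree i m))"
    if "i \<in> {1..N}" "m \<in> {1..N}" for i m
  proof -
    have "gdist ?G (?v i) (?v m) = card ({1..t} - ?agree i m)"
      using gdist_hamming_graph[OF v_in v_in, OF that] by (auto intro: arg_cong[of _ _ card])
    moreover have "card (?agree i m) \<le> card {1..t}"
      by (rule card_mono) auto
    ultimately show ?thesis
      by (subst (asm) card_Diff_subset) auto
  qed
  \<comment> \<open>This settles row gaps of at least \<open>t\<close>, about which the condition
    with \<open>s < t\<close> says nothing.\<close>
  have agree_less: "card (?agree i m) < t"
    if "inj_on ?v {1..N}" "i \<in> {1..N}" "m \<in> {1..N}" "i \<noteq> m" for i m
  proof -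
    have "?v i \<noteq> ?v m"
      using that by (auto dest: inj_onD)
    then have "\<exists>j\<in>{1..t}. ?v i j \<noteq> ?v m j"
      using PiE_ext[OF v_in[unfolded verts_hamming_graph] v_in[unfolded verts_hamming_graph]] that(2,3)
      by blast
    then have "?agree i m \<subset> {1..t}" by blast
    then show ?thesis
      using psubset_card_mono[of "{1..t}" "?agree i m"] by simp
  qed
  have "consecutive_radio_labeling ?G (induced_labeling ?G ?v) \<longleftrightarrow>
      (\<forall>i s. 1 < i \<and> i \<le> N \<and> 1 \<le> s \<and> s < t \<and> s < i \<longrightarrow> card (?agree i (i - s)) \<le> s - 1)"
    if inj: "inj_on ?v {1..N}"
  proof -
    have "consecutive_radio_labeling ?G (induced_labeling ?G ?v) \<longleftrightarrow>
      (\<forall>m i. 1 \<le> m \<and> m < i \<and> i \<le> N \<longrightarrow>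
         int t + 1 - int (gdist ?G (?v i) (?v m)) \<le> int i - int m)"
      using consecutive_induced_labeling_iff[OF _ sym, of ?v] inj
      by (simp add: ordering card_V diam)
    \<comment> \<open>By \<open>dist\<close>, the diameter \<open>t\<close> cancels: the bound reads
      \<open>card (?agree i m) + 1 \<le> i - m\<close>.\<close>
    also have "\<dots> \<longleftrightarrow> (\<forall>m i. 1 \<le> m \<and> m < i \<and> i \<le> N \<longrightarrow> card (?agree i m) < i - m)"
      by (intro all_cong1 imp_cong refl) (auto simp: dist)
    also have "\<dots> \<longleftrightarrow>
        (\<forall>i s. 1 < i \<and> i \<le> N \<and> 1 \<le> s \<and> s < t \<and> s < i \<longrightarrow> card (?agree i (i - s)) \<le> s - 1)"
      (is "?A \<longleftrightarrow> ?B")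
    proof
      assume A: ?A
      show ?B
      proof (intro allI impI)
        fix i s assume si: "1 < i \<and> i \<le> N \<and> 1 \<le> s \<and> s < t \<and> s < i"
        then have "card (?agree i (i - s)) < i - (i - s)"
          by (intro A[rule_format]) auto
        with si show "card (?agree i (i - s)) \<le> s - 1" by simp
      qed
    next
      assume B: ?B
      show ?A
      proof (intro allI impI)
        fix m i assume mi: "1 \<le> m \<and> m < i \<and> i \<le> N"
        show "card (?agree i m) < i - m"
        proof (cases "i - m < t")
          case True
          with mi have "card (?agree i (i - (i - m))) \<le> i - m - 1"
            by (intro B[rule_format]) auto
          with mi show ?thesis by auto
        next
          case False
          with agree_less[OF inj, of i m] mi show ?thesis by auto
        qed
      qed
    qed
    finally show ?thesis .
  qed
  moreover have "(\<forall>i s. 1 < i \<and> i \<le> N \<and> 1 \<le> s \<and> s < t \<and> s < i \<longrightarrow>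
         card (?agree i (i - s)) \<le> s - 1) \<longleftrightarrow>
      (\<forall>i s. 1 < i \<and> i \<le> N \<and> 1 \<le> s \<and> s < t \<and> s < i \<longrightarrow>
         card {j \<in> {1..t}.
                 perm_prod (map (\<lambda>l. \<sigma> l j) [i - s + 1..<i + 1])
                   \<in> Lam (\<Delta> j) s (i - s + 1) (map (\<lambda>l. \<sigma> l j) [1..<i - s + 1])}
           \<le> s - 1)"
    by (intro all_cong1 imp_cong refl) (simp only: Lam_set)
  ultimately show ?thesis
    unfolding ordering by blast
qed

end
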